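(* Let $f:\mathbb{R}^n\to\mathbb{R}$ be smooth, strongly convex with parameters $L\ge\ell>0$ and minimizer $x^*$. Let $\tilde\sigma_k$ be the scalars generated by the Geometric Descent (GD) algorithm applied to $f$ from an arbitrary $x_0\in\mathbb{R}^n$. Then for each $k=1,2,\ldots$, $$\tilde\sigma_k^2\le\left(1-\sqrt{\frac{\ell}{L}}\right)\tilde\sigma_{k-1}^2 .$$
   Context: A differentiable convex function $f:\mathbb{R}^n\to\mathbb{R}$ is smooth, strongly convex with parameters $L\ge\ell>0$ if for all $x,y\in\mathbb{R}^n$, $\ \ell\|x-y\|^2/2\le f(y)-f(x)-\nabla f(x)^T(y-x)\le L\|x-y\|^2/2$. Such $f$ has a unique minimizer $x^*$. $\mathrm{aff}$ denotes affine hull. Geometric Descent (GD): $x_0$ is arbitrary, $y_0:=x_0$, $\tilde\sigma_0:=\sqrt{2}\,\|\nabla f(x_0)\|/\ell$. For $k=1,2,\ldots$: - $\bar x_{k-1}:=x_{k-1}-\nabla f(x_{k-1})/L$ and $\bar{\bar x}_{k-1}:=x_{k-1}-\nabla f(x_{k-1})/\ell$. - $\tilde\rho_{k-1}:=\|\nabla f(x_{k-1})\|/\ell$. - If $\tilde\sigma_{k-1}^2\le 2\tilde\rho_{k-1}^2$, set $\delta_{k-1}:=\|y_{k-1}-\bar{\bar x}_{k-1}\|$, $$\lambda_k:=\frac{\delta_{k-1}^2+\tilde\rho_{k-1}^2-\tilde\sigma_{k-1}^2}{2\delta_{k-1}^2},\qquad \tilde\xi_k^*:=\frac12\sqrt{2\tilde\rho_{k-1}^2+2\tilde\sigma_{k-1}^2-\delta_{k-1}^2-\frac{(\tilde\rho_{k-1}^2-\tilde\sigma_{k-1}^2)^2}{\delta_{k-1}^2}}.$$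 Otherwise set $\lambda_k:=0$. - $y_k:=(1-\lambda_k)\bar{\bar x}_{k-1}+\lambda_k y_{k-1}$. - $x_k:=\mathrm{argmin}\{f(x):x\in\mathrm{aff}\{\bar x_{k-1},y_k\}\}$ (exact line search). - With $\gamma_j:=2(f(x_j)-f(x^* ))/\ell$ (so $\gamma_k-\gamma_{k-1}=2(f(x_k)-f(x_{k-1}))/\ell$), set $\tilde\sigma_k:=\sqrt{(\tilde\xi_k^* )^2-\gamma_{k-1}+\gamma_k}$ in the first case ($\tilde\sigma_{k-1}^2\le 2\tilde\rho_{k-1}^2$) and $\tilde\sigma_k:=\sqrt{\tilde\rho_{k-1}^2-\gamma_{k-1}+\gamma_k}$ in the other case. The formulas of the first case presuppose $\delta_{k-1}\ne0$; the algorithm is considered as long as these formulas are defined. *)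

theory Defs
  imports "HOL-Analysis.Analysis"
begin

definition grad :: "('a::euclidean_space \<Rightarrow> real) \<Rightarrow> 'a \<Rightarrow> 'a" where
  "grad f x = (THE D. GDERIV f x :> D)"

lemma GDERIV_unique:
  fixes f :: "'a::euclidean_space \<Rightarrow> real"
  assumes "GDERIV f x :> D" "GDERIV f x :> E"
  shows "D = E"
proof -
  have "(\<lambda>h. h \<bullet> D) = (\<lambda>h. h \<bullet> E)"
    using assms unfolding gderiv_def by (rule has_derivative_unique)
  then have "h \<bullet> D = h \<bullet> E" for h
    by (rule fun_cong)
  then show ?thesis
    by (metis inner_commute vector_eq_ldot)
qed

lemma grad_eq: "GDERIV f x :> D \<Longrightarrow> grad f x = D"
  unfolding grad_def by (blast intro: GDERIV_unique)

lemma GDERIV_grad: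
  assumes "f differentiable (at x)"
  shows "GDERIV f x :> grad f x"
proof -
  obtain f' where f': "(f has_derivative f') (at x)"
    using assms unfolding differentiable_def by blast
  then have "linear f'"
    by (rule has_derivative_linear)
  then have "f' h = h \<bullet> adjoint f' 1" for h
    using adjoint_works[of f' h 1] by simp
  with f' have "GDERIV f x :> adjoint f' 1"
    unfolding gderiv_def by (metis (no_types, lifting) ext)
  then show ?thesis
    using grad_eq by metis
qed

definition smooth_strongly_convex ::
    "('a::euclidean_space \<Rightarrow> real) \<Rightarrow> real \<Rightarrow> real \<Rightarrow> bool" where
  "smooth_strongly_convex f L l \<longleftrightarrow>
     0 < l \<and> l \<le> L \<and> convex_on UNIV f \<and> (\<forall>x. f differentiable (at x)) \<and>
     (\<forall>x y. l * (norm (x - y))\<^sup>2 / 2 \<le> f y - f x - grad f x \<bullet> (y - x) \<and>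
            f y - f x - grad f x \<bullet> (y - x) \<le> L * (norm (x - y))\<^sup>2 / 2)"

text \<open>One iteration, from \<open>(x, y, \<sigma>)\<close> to \<open>(x', y', \<sigma>')\<close>. Division by zero is excluded
  explicitly: an iteration in the first case exists only if \<open>\<delta> \<noteq> 0\<close>. Nonnegativity of the
  arguments of \<open>sqrt\<close> is not demanded (\<open>sqrt\<close> is odd on the negative reals); along
  a run on a smooth, strongly convex \<open>f\<close> with minimizer \<open>xstar\<close> it holds automatically.\<close>

definition gd_step ::
    "('a::euclidean_space \<Rightarrow> real) \<Rightarrow> real \<Rightarrow> real \<Rightarrow> 'a \<Rightarrow>
     'a \<Rightarrow> 'a \<Rightarrow> real \<Rightarrow> 'a \<Rightarrow> 'a \<Rightarrow> real \<Rightarrow> bool" where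
  "gd_step f L l xstar x y \<sigma> x' y' \<sigma>' \<longleftrightarrow>
     (let xbar = x - (1 / L) *\<^sub>R grad f x;
          xbarbar = x - (1 / l) *\<^sub>R grad f x;
          \<rho> = norm (grad f x) / l;
          first_case = (\<sigma>\<^sup>2 \<le> 2 * \<rho>\<^sup>2);
          \<delta> = norm (y - xbarbar);
          lam = (if first_case then (\<delta>\<^sup>2 + \<rho>\<^sup>2 - \<sigma>\<^sup>2) / (2 * \<delta>\<^sup>2) else 0);
          \<xi> = 1 / 2 * sqrt (2 * \<rho>\<^sup>2 + 2 * \<sigma>\<^sup>2 - \<delta>\<^sup>2 - (\<rho>\<^sup>2 - \<sigma>\<^sup>2)\<^sup>2 / \<delta>\<^sup>2);
          \<gamma> = (\<lambda>z. 2 * (f z - f xstar) / l)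
      in (first_case \<longrightarrow> \<delta> \<noteq> 0) \<and>
         y' = (1 - lam) *\<^sub>R xbarbar + lam *\<^sub>R y \<and>
         is_arg_min f (\<lambda>z. z \<in> affine hull {xbar, y'}) x' \<and>
         \<sigma>' = (if first_case then sqrt (\<xi>\<^sup>2 - \<gamma> x + \<gamma> x') else sqrt (\<rho>\<^sup>2 - \<gamma> x + \<gamma> x')))"

text \<open>The sequences record \<open>N\<close> successfully executed iterations; their values beyond index \<open>N\<close>
  are irrelevant. Since \<open>N\<close> is arbitrary, this covers both runs that stop because the next
  iteration is undefined and runs that go on forever.\<close>

definition gd_run ::
    "('a::euclidean_space \<Rightarrow> real) \<Rightarrow> real \<Rightarrow> real \<Rightarrow> 'a \<Rightarrow> nat \<Rightarrow>
     (nat \<Rightarrow> 'a) \<Rightarrow> (nat \<Rightarrow> 'a) \<Rightarrow> (nat \<Rightarrow> real) \<Rightarrow> bool" where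
  "gd_run f L l xstar N x y \<sigma> \<longleftrightarrow>
     y 0 = x 0 \<and> \<sigma> 0 = sqrt 2 * norm (grad f (x 0)) / l \<and>
     (\<forall>k\<in>{1..N}. gd_step f L l xstar (x (k - 1)) (y (k - 1)) (\<sigma> (k - 1)) (x k) (y k) (\<sigma> k))"

end

theory Submission imports Defs begin

text \<open>
  Write \<open>\<gamma> z = 2 (f z - f x\<^sup>*) / l\<close>. A run preserves two invariants:
  \<open>\<parallel>x\<^sup>* - y\<parallel>\<^sup>2 \<le> \<sigma>\<^sup>2 - \<gamma> x\<close>, and \<open>grad f x\<close> is orthogonal to \<open>x - y\<close> because of the exact line search.
  By orthogonality \<open>\<delta>\<^sup>2 = \<parallel>x - y\<parallel>\<^sup>2 + \<rho>\<^sup>2 \<ge> \<rho>\<^sup>2\<close>, so in the first case \<open>\<lambda> \<in> [0, 1]\<close>, and \<open>y'\<close>,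
  \<open>\<xi>\<close> are the centre and radius of a ball enclosing the intersection of the balls around the
  second gradient point and \<open>y\<close>. This carries the first invariant over, and it also shows that
  all square roots have nonnegative arguments. Since \<open>\<xi>\<^sup>2\<close> decreases in \<open>\<delta>\<^sup>2 \<ge> \<rho>\<^sup>2\<close>,
  \<open>\<xi>\<^sup>2 \<le> \<sigma>\<^sup>2 - \<sigma>\<^sup>4 / (4 \<rho>\<^sup>2)\<close>. The line search also gives \<open>\<gamma> x' - \<gamma> x \<le> - (l / L) \<rho>\<^sup>2\<close>, and
  the claimed contraction is AM-GM for \<open>\<sigma>\<^sup>4 / (4 \<rho>\<^sup>2)\<close> and \<open>(l / L) \<rho>\<^sup>2\<close>.
\<close>

context
  fixes f :: "'a::euclidean_space \<Rightarrow> real" and L l :: real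
  assumes ssc: "smooth_strongly_convex f L l"
begin

lemma parameters_pos: "0 < l" "0 < L" "l \<le> L"
  using ssc unfolding smooth_strongly_convex_def by auto

lemma strong_convexity_bound: "f z + grad f z \<bullet> (w - z) + l * (norm (w - z))\<^sup>2 / 2 \<le> f w"
  using ssc unfolding smooth_strongly_convex_def by (smt (verit) norm_minus_commute)

lemma smoothness_bound: "f w \<le> f z + grad f z \<bullet> (w - z) + L * (norm (w - z))\<^sup>2 / 2"
  using ssc unfolding smooth_strongly_convex_def by (smt (verit) norm_minus_commute)

lemma gradient_step_decrease:
  "f (z - (1 / L) *\<^sub>R grad f z) \<le> f z - (norm (grad f z))\<^sup>2 / (2 * L)"
proof -
  have "grad f z \<bullet> (- (1 / L) *\<^sub>R grad f z) + L * (norm (- (1 / L) *\<^sub>R grad f z))\<^sup>2 / 2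
      = - ((norm (grad f z))\<^sup>2 / (2 * L))"
    using parameters_pos
    by (simp add: power_mult_distrib power_divide flip: power2_norm_eq_inner)
       (simp add: field_simps power2_eq_square)
  then show ?thesis
    using smoothness_bound[of "z - (1 / L) *\<^sub>R grad f z" z] by simp
qed

text \<open>Complete the square and apply \<open>2 / l\<close> times the strong convexity bound.
  With \<open>w\<close> the minimizer, this is the ball around the second gradient point.\<close>

lemma dist_minimizer_second_gradient_point:
  "(norm (w - (z - (1 / l) *\<^sub>R grad f z)))\<^sup>2 \<le> (norm (grad f z) / l)\<^sup>2 - 2 * (f z - f w) / l"
proof -
  have "(norm (w - (z - (1 / l) *\<^sub>R grad f z)))\<^sup>2
      = (norm (w - z))\<^sup>2 + 2 / l * (grad f z \<bullet> (w - z)) + (norm (grad f z) / l)\<^sup>2"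
    unfolding power2_norm_eq_inner power_divide
    by (simp add: inner_diff inner_add inner_commute algebra_simps power2_eq_square)
  moreover have "(norm (w - z))\<^sup>2 + 2 / l * (grad f z \<bullet> (w - z)) \<le> - (2 * (f z - f w) / l)"
    using mult_left_mono[OF strong_convexity_bound[of z w], of "2 / l"] parameters_pos
    by (simp add: algebra_simps add_divide_distrib diff_divide_distrib)
  ultimately show ?thesis by linarith
qed

lemma grad_minimizer_line_orthogonal:
  assumes "\<And>t. f z \<le> f (z + t *\<^sub>R d)"
  shows "grad f z \<bullet> d = 0"
proof (cases "d = 0")
  case False
  define c where "c = grad f z \<bullet> d"
  define n where "n = (norm d)\<^sup>2"
  have n: "n > 0" using False by (simp add: n_def)
  have "0 \<le> t * c + L * (t\<^sup>2 * n) / 2" for t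
    using assms[of t] smoothness_bound[of "z + t *\<^sub>R d" z]
    by (simp add: c_def n_def power_mult_distrib)
  \<comment> \<open>The minimizer of the quadratic in \<open>t\<close>, whose value there is
    \<open>- c\<^sup>2 / (2 * L * n)\<close>.\<close>
  from this[of "- c / (L * n)"] have "c\<^sup>2 / (2 * L * n) \<le> 0"
    using n parameters_pos by (simp add: field_simps power2_eq_square)
  then have "c\<^sup>2 \<le> 0"
    using mult_pos_pos[OF parameters_pos(2) n] by (simp add: divide_le_0_iff)
  then show ?thesis by (simp add: c_def)
qed simp

lemma grad_orthogonal_exact_line_search:
  assumes "is_arg_min f (\<lambda>z. z \<in> affine hull {u, v}) w"
  shows "grad f w \<bullet> (w - v) = 0"
proof (rule grad_minimizer_line_orthogonal)
  fix t
  have "w \<in> affine hull {u, v}" "v \<in> affine hull {u, v}"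
    using assms by (auto simp: is_arg_min_def hull_inc)
  then have "w + t *\<^sub>R (w - v) \<in> affine hull {u, v}"
    using mem_affine[of "affine hull {u, v}" w v "1 + t" "- t"]
    by (simp add: affine_affine_hull algebra_simps)
  then show "f w \<le> f (w + t *\<^sub>R (w - v))"
    using assms by (force simp: is_arg_min_def)
qed

text \<open>Explains the factor \<open>sqrt 2\<close> in the initial radius: with g the scaled gap,
  strong convexity at \<open>xstar\<close> bounds the squared distance by g, and g is at most
  \<open>r\<close>, hence g is at most 2r - g.\<close>

lemma dist_minimizer_initial:
  assumes "is_arg_min f (\<lambda>_. True) xstar"
  shows "(norm (xstar - z))\<^sup>2 \<le> (sqrt 2 * norm (grad f z) / l)\<^sup>2 - 2 * (f z - f xstar) / l"
proof -
  define r where "r = (norm (grad f z) / l)\<^sup>2"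
  have fmin: "f xstar \<le> f w" for w
    using assms by (auto simp: is_arg_min_def not_less)
  have "grad f xstar \<bullet> (z - xstar) = 0"
    by (rule grad_minimizer_line_orthogonal) (rule fmin)
  then have "(norm (xstar - z))\<^sup>2 \<le> 2 * (f z - f xstar) / l"
    using strong_convexity_bound[of xstar z] parameters_pos
    by (simp add: field_simps norm_minus_commute)
  moreover have "0 \<le> r - 2 * (f z - f xstar) / l"
    using order_trans[OF zero_le_power2 dist_minimizer_second_gradient_point]
    unfolding r_def .
  moreover have "(sqrt 2 * norm (grad f z) / l)\<^sup>2 = 2 * r"
    by (simp add: r_def power_divide power_mult_distrib)
  ultimately show ?thesis by linarith
qed

end

text \<open>Stewart's theorem, for arbitrary real \<open>t\<close>.\<close>

lemma norm_affine_combination_sq: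
  fixes a b p :: "'a::real_inner"
  shows "(norm (p - ((1 - t) *\<^sub>R a + t *\<^sub>R b)))\<^sup>2
    = (1 - t) * (norm (p - a))\<^sup>2 + t * (norm (p - b))\<^sup>2 - t * (1 - t) * (norm (b - a))\<^sup>2"
  unfolding power2_norm_eq_inner
  by (simp add: inner_diff inner_add inner_commute algebra_simps)

text \<open>In the next two lemmas \<open>R\<close>, \<open>S\<close>, \<open>D\<close> stand for \<open>\<rho>\<^sup>2\<close>, \<open>\<sigma>\<^sup>2\<close>, \<open>\<delta>\<^sup>2\<close>.\<close>

lemma ball_intersection_enclosing:
  fixes a b p :: "'a::real_inner"
  assumes "(norm (p - a))\<^sup>2 \<le> R - g" "(norm (p - b))\<^sup>2 \<le> S - g"
    and D: "D = (norm (b - a))\<^sup>2" "D \<noteq> 0" "\<bar>R - S\<bar> \<le> D"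
    and t: "t = (D + R - S) / (2 * D)"
  shows "(norm (p - ((1 - t) *\<^sub>R a + t *\<^sub>R b)))\<^sup>2
    \<le> (2 * R + 2 * S - D - (R - S)\<^sup>2 / D) / 4 - g"
proof -
  have Dpos: "0 < D" using D(1,2) by (metis zero_le_power2 less_eq_real_def)
  have t01: "0 \<le> t" "t \<le> 1" using D(3) Dpos by (auto simp: t field_simps)
  \<comment> \<open>As a quadratic in \<open>t\<close>, this bound is smallest at the given
    \<open>t\<close>. The weights sum to 1, so \<open>g\<close> comes through unchanged.\<close>
  have "(norm (p - ((1 - t) *\<^sub>R a + t *\<^sub>R b)))\<^sup>2
      \<le> (1 - t) * (R - g) + t * (S - g) - t * (1 - t) * D"
    unfolding norm_affine_combination_sq D(1)[symmetric]
    using mult_left_mono[OF assms(1), of "1 - t"] mult_left_mono[OF assms(2), of t] t01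
    by linarith
  also have "\<dots> = (2 * R + 2 * S - D - (R - S)\<^sup>2 / D) / 4 - g"
    using Dpos by (simp add: t field_simps power2_eq_square)
  finally show ?thesis .
qed

lemma enclosing_radius_contraction:
  fixes R S D e :: real
  assumes R: "0 \<le> R" and S: "0 \<le> S" "S \<le> 2 * R" and D: "R \<le> D" "0 < D"
  shows "(2 * R + 2 * S - D - (R - S)\<^sup>2 / D) / 4 - e\<^sup>2 * R \<le> (1 - e) * S"
proof (cases "R = 0")
  case True
  then show ?thesis using S D by simp
next
  case False
  then have Rpos: "0 < R" using R by simp
  have "\<bar>R - S\<bar> \<le> R" using S by linarith
  then have "(R - S)\<^sup>2 \<le> R\<^sup>2" by (metis abs_le_square_iff abs_of_nonneg R)
  also have "\<dots> \<le> R * D" using D R by (simp add: power2_eq_square mult_left_mono)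
  \<comment> \<open>Divided by \<open>R * D\<close>, this product is the difference of the values of
    z + \<open>(R - S)\<^sup>2\<close>/z at \<open>D\<close> and at \<open>R\<close>.\<close>
  finally have "0 \<le> (D - R) * (R * D - (R - S)\<^sup>2)" using D by simp
  then have "R + (R - S)\<^sup>2 / R \<le> D + (R - S)\<^sup>2 / D"
    using Rpos D by (simp add: divide_simps) (simp add: algebra_simps power2_eq_square)
  then have "(2 * R + 2 * S - D - (R - S)\<^sup>2 / D) / 4 \<le> (2 * R + 2 * S - R - (R - S)\<^sup>2 / R) / 4"
    by (intro divide_right_mono) simp_all
  also have "\<dots> = S - S\<^sup>2 / (4 * R)"
    using Rpos by (simp add: field_simps power2_eq_square)
  finally have "(2 * R + 2 * S - D - (R - S)\<^sup>2 / D) / 4 \<le> S - S\<^sup>2 / (4 * R)" .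
  \<comment> \<open>AM-GM in the form of a square; the cross term is \<open>e * S\<close>.\<close>
  moreover have "0 \<le> (S - 2 * e * R)\<^sup>2 / (4 * R)" using Rpos by simp
  then have "e * S \<le> S\<^sup>2 / (4 * R) + e\<^sup>2 * R"
    using Rpos by (simp add: field_simps power2_eq_square)
  moreover have "(1 - e) * S = S - e * S" by (simp add: algebra_simps)
  ultimately show ?thesis by linarith
qed

text \<open>The gap is subtracted so that the change of gap added to the squared radius after the
  line search cancels.\<close>

definition gd_invariant ::
    "('a::euclidean_space \<Rightarrow> real) \<Rightarrow> real \<Rightarrow> 'a \<Rightarrow> 'a \<Rightarrow> 'a \<Rightarrow> real \<Rightarrow> bool" where
  "gd_invariant f l xstar x y \<sigma> \<longleftrightarrow>
     grad f x \<bullet> (x - y) = 0 \<and> (norm (xstar - y))\<^sup>2 \<le> \<sigma>\<^sup>2 - 2 * (f x - f xstar) / l"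

lemma gd_step_invariant_contraction:
  assumes ssc: "smooth_strongly_convex f L l"
    and xstar: "is_arg_min f (\<lambda>_. True) xstar"
    and inv: "gd_invariant f l xstar x y \<sigma>"
    and step: "gd_step f L l xstar x y \<sigma> x' y' \<sigma>'"
  shows "gd_invariant f l xstar x' y' \<sigma>'" and "\<sigma>'\<^sup>2 \<le> (1 - sqrt (l / L)) * \<sigma>\<^sup>2"
proof -
  note pos = parameters_pos[OF ssc]
  define b where "b = x - (1 / l) *\<^sub>R grad f x"
  define \<rho> where "\<rho> = norm (grad f x) / l"
  define \<delta> where "\<delta> = norm (y - b)"
  define \<gamma> where "\<gamma> z = 2 * (f z - f xstar) / l" for z
  define e where "e = sqrt (l / L)"
  define X where "X = (2 * \<rho>\<^sup>2 + 2 * \<sigma>\<^sup>2 - \<delta>\<^sup>2 - (\<rho>\<^sup>2 - \<sigma>\<^sup>2)\<^sup>2 / \<delta>\<^sup>2) / 4"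
  define lam where "lam = (if \<sigma>\<^sup>2 \<le> 2 * \<rho>\<^sup>2 then (\<delta>\<^sup>2 + \<rho>\<^sup>2 - \<sigma>\<^sup>2) / (2 * \<delta>\<^sup>2) else 0)"
  \<comment> \<open>The squared radius around \<open>y'\<close> before the line search progress is
    credited; in the second case \<open>y' = b\<close>.\<close>
  define A where "A = (if \<sigma>\<^sup>2 \<le> 2 * \<rho>\<^sup>2 then X else \<rho>\<^sup>2)"
  have X4: "2 * \<rho>\<^sup>2 + 2 * \<sigma>\<^sup>2 - \<delta>\<^sup>2 - (\<rho>\<^sup>2 - \<sigma>\<^sup>2)\<^sup>2 / \<delta>\<^sup>2 = 4 * X"
    by (simp add: X_def)
  have \<delta>0: "\<sigma>\<^sup>2 \<le> 2 * \<rho>\<^sup>2 \<Longrightarrow> \<delta> \<noteq> 0"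
    and y': "y' = (1 - lam) *\<^sub>R b + lam *\<^sub>R y"
    and x': "is_arg_min f (\<lambda>z. z \<in> affine hull {x - (1 / L) *\<^sub>R grad f x, y'}) x'"
    and \<sigma>': "\<sigma>' = (if \<sigma>\<^sup>2 \<le> 2 * \<rho>\<^sup>2 then sqrt ((1 / 2 * sqrt (4 * X))\<^sup>2 - \<gamma> x + \<gamma> x')
      else sqrt (\<rho>\<^sup>2 - \<gamma> x + \<gamma> x'))"
    using step unfolding gd_step_def Let_def b_def[symmetric] \<rho>_def[symmetric]
      \<delta>_def[symmetric] \<gamma>_def[symmetric] lam_def[symmetric] X4
    by auto
  have \<gamma>_nonneg: "0 \<le> \<gamma> z" for z
    using xstar pos by (auto simp: \<gamma>_def is_arg_min_def not_less)
  have e: "0 \<le> e" "e \<le> 1" "e\<^sup>2 = l / L"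
    using pos by (auto simp: e_def)
  have ortho: "grad f x \<bullet> (x - y) = 0" and ball_y: "(norm (xstar - y))\<^sup>2 \<le> \<sigma>\<^sup>2 - \<gamma> x"
    using inv by (auto simp: gd_invariant_def \<gamma>_def)
  have ball_b: "(norm (xstar - b))\<^sup>2 \<le> \<rho>\<^sup>2 - \<gamma> x"
    using dist_minimizer_second_gradient_point[OF ssc] by (simp add: b_def \<rho>_def \<gamma>_def)
  have "\<delta>\<^sup>2 = (norm (x - y))\<^sup>2 - 2 / l * (grad f x \<bullet> (x - y)) + \<rho>\<^sup>2"
    unfolding \<delta>_def b_def \<rho>_def power2_norm_eq_inner power_divide
    by (simp add: inner_diff inner_add inner_commute algebra_simps power2_eq_square)
  then have \<delta>_ge: "\<rho>\<^sup>2 \<le> \<delta>\<^sup>2" using ortho by simp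
  have ball_y': "(norm (xstar - y'))\<^sup>2 \<le> A - \<gamma> x"
  proof (cases "\<sigma>\<^sup>2 \<le> 2 * \<rho>\<^sup>2")
    case True
    \<comment> \<open>The case condition puts \<open>\<sigma>\<^sup>2\<close> between 0 and
      \<open>2 * \<rho>\<^sup>2\<close>, so the difference is at most \<open>\<rho>\<^sup>2\<close>
      in absolute value.\<close>
    have "\<bar>\<rho>\<^sup>2 - \<sigma>\<^sup>2\<bar> \<le> \<delta>\<^sup>2" using True \<delta>_ge zero_le_power2[of \<sigma>] by linarith
    then show ?thesis
      using ball_intersection_enclosing[OF ball_b ball_y, of "\<delta>\<^sup>2" lam] \<delta>0 True
      by (simp add: y' A_def X_def lam_def \<delta>_def)
  next
    case False
    then show ?thesis using ball_b by (simp add: y' A_def lam_def)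
  qed
  \<comment> \<open>A squared norm lies below \<open>A - \<gamma> x\<close>; hence both the inner
    and the outer radicand are nonnegative and squaring undoes the roots.\<close>
  then have A: "0 \<le> A - \<gamma> x" using zero_le_power2 order_trans by blast
  then have "0 \<le> A" using \<gamma>_nonneg[of x] by linarith
  then have "\<sigma>' = sqrt (A - \<gamma> x + \<gamma> x')"
    by (simp add: \<sigma>' A_def power_mult_distrib power_divide split: if_splits)
  then have \<sigma>'_sq: "\<sigma>'\<^sup>2 = A - \<gamma> x + \<gamma> x'"
    using A \<gamma>_nonneg[of x'] by simp
  show "gd_invariant f l xstar x' y' \<sigma>'"
    unfolding gd_invariant_def \<gamma>_def[symmetric]
    using grad_orthogonal_exact_line_search[OF ssc x'] ball_y' \<sigma>'_sq by simp
  \<comment> \<open>The search line is used twice: its point \<open>y'\<close> gave orthogonality,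
    its gradient point now gives the decrease.\<close>
  have "x - (1 / L) *\<^sub>R grad f x \<in> affine hull {x - (1 / L) *\<^sub>R grad f x, y'}"
    by (simp add: hull_inc)
  then have "f x' \<le> f (x - (1 / L) *\<^sub>R grad f x)"
    using x' by (force simp: is_arg_min_def)
  also note gradient_step_decrease[OF ssc]
  finally have "2 / l * (f x' - f x) \<le> 2 / l * (- (norm (grad f x))\<^sup>2 / (2 * L))"
    using pos by (intro mult_left_mono) auto
  then have "\<gamma> x' - \<gamma> x \<le> - ((norm (grad f x))\<^sup>2 / (L * l))"
    by (simp add: \<gamma>_def diff_divide_distrib right_diff_distrib mult.commute)
  also have "(norm (grad f x))\<^sup>2 / (L * l) = e\<^sup>2 * \<rho>\<^sup>2"
    unfolding e(3) \<rho>_def power_divide using pos by (simp add: power2_eq_square)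
  finally have decrease: "\<gamma> x' - \<gamma> x \<le> - (e\<^sup>2 * \<rho>\<^sup>2)" .
  have "A - e\<^sup>2 * \<rho>\<^sup>2 \<le> (1 - e) * \<sigma>\<^sup>2"
  proof (cases "\<sigma>\<^sup>2 \<le> 2 * \<rho>\<^sup>2")
    case True
    then show ?thesis
      using enclosing_radius_contraction[of "\<rho>\<^sup>2" "\<sigma>\<^sup>2" "\<delta>\<^sup>2" e] \<delta>_ge \<delta>0
      by (simp add: A_def X_def)
  next
    case False
    \<comment> \<open>Factor \<open>1 - e\<^sup>2\<close>, then use \<open>e \<le> 1\<close> and the
      failed case condition.\<close>
    have "\<rho>\<^sup>2 - e\<^sup>2 * \<rho>\<^sup>2 = (1 - e) * ((1 + e) * \<rho>\<^sup>2)"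
      by (simp add: algebra_simps power2_eq_square)
    also have "\<dots> \<le> (1 - e) * (2 * \<rho>\<^sup>2)"
      using e by (intro mult_left_mono mult_right_mono) auto
    also have "\<dots> \<le> (1 - e) * \<sigma>\<^sup>2"
      using e False by (intro mult_left_mono) auto
    finally show ?thesis using False by (simp add: A_def)
  qed
  then show "\<sigma>'\<^sup>2 \<le> (1 - sqrt (l / L)) * \<sigma>\<^sup>2"
    using \<sigma>'_sq decrease by (simp add: e_def)
qed

theorem theorem3:
  fixes f :: "real ^ 'n \<Rightarrow> real" and L l :: real and xstar :: "real ^ 'n"
    and x y :: "nat \<Rightarrow> real ^ 'n" and \<sigma> :: "nat \<Rightarrow> real" and N :: nat
  assumes "smooth_strongly_convex f L l"
    and "is_arg_min f (\<lambda>_. True) xstar"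
    and "gd_run f L l xstar N x y \<sigma>"
  shows "\<forall>k\<in>{1..N}. (\<sigma> k)\<^sup>2 \<le> (1 - sqrt (l / L)) * (\<sigma> (k - 1))\<^sup>2"
proof -
  have init: "y 0 = x 0" "\<sigma> 0 = sqrt 2 * norm (grad f (x 0)) / l"
    and step: "\<And>k. k < N \<Longrightarrow> gd_step f L l xstar (x k) (y k) (\<sigma> k) (x (Suc k)) (y (Suc k)) (\<sigma> (Suc k))"
    using assms(3) unfolding gd_run_def by force+
  have inv: "gd_invariant f l xstar (x k) (y k) (\<sigma> k)" if "k \<le> N" for k
    using that
  proof (induction k)
    case 0
    show ?case
      using dist_minimizer_initial[OF assms(1,2), of "x 0"] by (simp add: gd_invariant_def init)
  next
    case (Suc k)
    then show ?case
      using gd_step_invariant_contraction(1)[OF assms(1,2) _ step] by simp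
  qed
  show ?thesis
  proof
    fix k assume "k \<in> {1..N}"
    then obtain j where "k = Suc j" "j < N" by (cases k) auto
    then show "(\<sigma> k)\<^sup>2 \<le> (1 - sqrt (l / L)) * (\<sigma> (k - 1))\<^sup>2"
      using gd_step_invariant_contraction(2)[OF assms(1,2) inv step, of j] by simp
  qed
qed

end
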